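(* Let $W\subset\mathbb{P}^3=\mathbb{P}^3(\mathbb{C})$ be the set of $31$ points consisting of the $27$ points $(1:\varepsilon^{\alpha}:\varepsilon^{\beta}:\varepsilon^{\gamma})$ with $1\le \alpha,\beta,\gamma\le 3$, where $\varepsilon$ is a primitive cube root of unity, together with the four coordinate points $(1:0:0:0)$, $(0:1:0:0)$, $(0:0:1:0)$, $(0:0:0:1)$. Then the linear system $\mathcal{L}_3(4;W,3)$ is special, i.e., for any point $R=(a:b:c:d)$ in $\mathbb{P}^3\setminus W$ there exists a quartic $Q_R$ vanishing to order $3$ at $R$ and vanishing at all points of $W$. Moreover, the quartic $Q_R$ has $4$ additional singularities at $$R_1=(-2a:b:c:d),\quad R_2=(a:-2b:c:d),\quad R_3=(a:b:-2c:d),\quad R_4=(a:b:c:-2d).$$ These singularities are double points.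
   Context: The ground field is $\mathbb{C}$, and $x,y,z,w$ are the homogeneous coordinates on $\mathbb{P}^3$. A quartic is a surface given by a nonzero form of degree $4$ in $\mathbb{C}[x,y,z,w]$. A form "vanishes to order $m$ at a point" if its multiplicity there is at least $m$ (all partial derivatives of order less than $m$ vanish at the point). A double point of a surface is a point of multiplicity $2$. For a finite set $Z\subset\mathbb{P}^N$ of points (taken with multiplicity $1$), generic points $P_1,\dots,P_s$ and positive integers $m_1,\dots,m_s$, $\mathcal{L}_N(d;Z,m_1,\dots,m_s)$ denotes the linear system (projectivized vector space) of hypersurfaces of degree $d$ in $\mathbb{P}^N$ passing through every point of $Z$ and having multiplicity at least $m_i$ at $P_i$ for all $i$. Its expected dimension is the maximum of $-1$ and the number obtained by the naive count of conditions: each generic point $P_i$ is expected to impose $\binom{N+m_i-1}{N}$ conditions on the vector space of degree $d$ forms vanishing on $Z$, and one further subtracts $1$ to obtain the projective dimension. The system is called special if its actual projective dimension is strictly larger than the expected one. For $\mathcal{L}_3(4;W,3)$ the expected dimension is $-1$ (the system is expected to be empty), since quartics vanishing on $W$ form a vector space of dimension $8$ and a triple point imposes $10$ conditions.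
   Formalization: R_i is claimed additional only if the i-th coordinate of R is nonzero (else R_i = R), and a double point only if moreover R is not on a line joining the i-th coordinate point to another point of W; e.g. for R=(2:1:1:1) the unique Q_R is a cone, triple at R_1. *)

theory Defs
  imports "HOL-Analysis.Analysis" "HOL-Library.Poly_Mapping"
begin

text \<open>
  Polynomials over the complex numbers in the variables indexed by \<open>'i\<close>, as finitely supported
  maps from exponent vectors to coefficients.
\<close>

type_synonym 'i cpoly = "('i \<Rightarrow>\<^sub>0 nat) \<Rightarrow>\<^sub>0 complex"

definition cscale :: "complex \<Rightarrow> 'i cpoly \<Rightarrow> 'i cpoly" where
  "cscale c p = Poly_Mapping.map ((*) c) p"

interpretation cpoly: vector_space "cscale :: complex \<Rightarrow> 'i cpoly \<Rightarrow> 'i cpoly"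
  by unfold_locales
    (simp_all add: cscale_def mult_map_scale_conv_mult algebra_simps single_add mult_single
      flip: mult.assoc)

definition evalp :: "'i::finite cpoly \<Rightarrow> ('i \<Rightarrow> complex) \<Rightarrow> complex" where
  "evalp p v =
     (\<Sum>t\<in>Poly_Mapping.keys p. Poly_Mapping.lookup p t * (\<Prod>i\<in>UNIV. v i ^ Poly_Mapping.lookup t i))"

text \<open>
  Formal partial derivative. The truncated subtraction of exponents is harmless, since the
  coefficient vanishes whenever the exponent of the variable is 0.
\<close>

definition pdiff :: "'i \<Rightarrow> 'i cpoly \<Rightarrow> 'i cpoly" where
  "pdiff i p =
     (\<Sum>t\<in>Poly_Mapping.keys p.
        Poly_Mapping.single (t - Poly_Mapping.single i 1)
          (of_nat (Poly_Mapping.lookup t i) * Poly_Mapping.lookup p t))"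

text \<open>The zero polynomial counts as a form of every degree.\<close>

definition is_form :: "nat \<Rightarrow> 'i::finite cpoly \<Rightarrow> bool" where
  "is_form d p \<longleftrightarrow>
     (\<forall>t\<in>Poly_Mapping.keys p. (\<Sum>i\<in>UNIV. Poly_Mapping.lookup t i) = d)"

text \<open>
  The projective space of dimension \<open>CARD('n) - 1\<close>: points are given by nonzero vectors of
  homogeneous coordinates, and two such vectors give the same point iff they are proportional.
\<close>

definition proj_eq :: "complex^'n \<Rightarrow> complex^'n \<Rightarrow> bool" where
  "proj_eq u v \<longleftrightarrow> (\<exists>c. c \<noteq> 0 \<and> v = c *s u)"

definition vanishes_at :: "'n::finite cpoly \<Rightarrow> complex^'n \<Rightarrow> bool" where
  "vanishes_at p v \<longleftrightarrow> evalp p (($) v) = 0"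

text \<open>Lists of variables of length \<open>k\<close> index the partial derivatives of order \<open>k\<close>.\<close>

definition vanishes_to_order :: "nat \<Rightarrow> 'n::finite cpoly \<Rightarrow> complex^'n \<Rightarrow> bool" where
  "vanishes_to_order m p v \<longleftrightarrow> (\<forall>is. length is < m \<longrightarrow> vanishes_at (fold pdiff is p) v)"

definition singular_at :: "'n::finite cpoly \<Rightarrow> complex^'n \<Rightarrow> bool" where
  "singular_at p v \<longleftrightarrow> vanishes_to_order 2 p v"

definition double_point :: "'n::finite cpoly \<Rightarrow> complex^'n \<Rightarrow> bool" where
  "double_point p v \<longleftrightarrow> vanishes_to_order 2 p v \<and> \<not> vanishes_to_order 3 p v"

definition forms_through :: "nat \<Rightarrow> (complex^'n) set \<Rightarrow> 'n::finite cpoly set" where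
  "forms_through d Z = {p. is_form d p \<and> (\<forall>z\<in>Z. vanishes_at p z)}"

text \<open>
  The vector space whose projectivization is the linear system of hypersurfaces of degree \<open>d\<close>
  through \<open>Z\<close> with multiplicity at least \<open>m i\<close> at \<open>P i\<close>; the finite type \<open>'s\<close> indexes the
  points.
\<close>

definition linear_system ::
  "nat \<Rightarrow> (complex^'n) set \<Rightarrow> ('s::finite \<Rightarrow> nat) \<Rightarrow> ('s \<Rightarrow> complex^'n) \<Rightarrow> 'n::finite cpoly set" where
  "linear_system d Z m P = {p \<in> forms_through d Z. \<forall>i. vanishes_to_order (m i) p (P i)}"

definition proj_dim :: "'i cpoly set \<Rightarrow> int" where
  "proj_dim V = int (cpoly.dim V) - 1"

definition expected_dim :: "nat \<Rightarrow> (complex^'n::finite) set \<Rightarrow> ('s::finite \<Rightarrow> nat) \<Rightarrow> int" where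
  "expected_dim d Z m =
     max (-1)
       (int (cpoly.dim (forms_through d Z))
          - (\<Sum>i\<in>UNIV. int ((CARD('n) - 1 + m i - 1) choose (CARD('n) - 1))) - 1)"

text \<open>
  A property holds for generic points \<open>P i\<close> if it holds off the zero locus of some nonzero
  polynomial in all their homogeneous coordinates. For properties that do not depend on the choice
  of homogeneous coordinates, as below, this means: on a nonempty Zariski open subset of the product
  of projective spaces.
\<close>

definition for_generic_points :: "(('s::finite \<Rightarrow> complex^'n::finite) \<Rightarrow> bool) \<Rightarrow> bool" where
  "for_generic_points \<Phi> \<longleftrightarrow>
     (\<exists>F :: ('s \<times> 'n) cpoly. F \<noteq> 0 \<and>
        (\<forall>P. (\<forall>i. P i \<noteq> 0) \<and> evalp F (\<lambda>(i, j). P i $ j) \<noteq> 0 \<longrightarrow> \<Phi> P))"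

definition special_system ::
  "nat \<Rightarrow> (complex^'n::finite) set \<Rightarrow> ('s::finite \<Rightarrow> nat) \<Rightarrow> bool" where
  "special_system d Z m \<longleftrightarrow>
     for_generic_points (\<lambda>P :: 's \<Rightarrow> complex^'n.
       expected_dim d Z m < proj_dim (linear_system d Z m P))"

definition primitive_cube_root :: "complex \<Rightarrow> bool" where
  "primitive_cube_root \<epsilon> \<longleftrightarrow> \<epsilon> ^ 3 = 1 \<and> (\<forall>k\<in>{1, 2}. \<epsilon> ^ k \<noteq> 1)"

definition fermat_points :: "complex \<Rightarrow> (complex^4) set" where
  "fermat_points \<epsilon> =
     {vector [1, \<epsilon> ^ \<alpha>, \<epsilon> ^ \<beta>, \<epsilon> ^ \<gamma>] | \<alpha> \<beta> \<gamma>. \<alpha> \<in> {1..3} \<and> \<beta> \<in> {1..3} \<and> \<gamma> \<in> {1..3}}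
     \<union> {vector [1, 0, 0, 0], vector [0, 1, 0, 0], vector [0, 0, 1, 0], vector [0, 0, 0, 1]}"

text \<open>Multiply the \<open>i\<close>-th coordinate by \<open>-2\<close>.\<close>

definition twist :: "'n::finite \<Rightarrow> complex^'n \<Rightarrow> complex^'n" where
  "twist i R = (\<chi> j. if j = i then - 2 * R $ j else R $ j)"

definition on_line_through :: "complex^'n::finite \<Rightarrow> complex^'n \<Rightarrow> complex^'n \<Rightarrow> bool" where
  "on_line_through P Q R \<longleftrightarrow> R \<in> vec.span {P, Q}"

end

theory Submission
  imports Defs
begin

text \<open>
  A quartic through the coordinate points that vanishes on the 27 other points of \<open>W\<close> has the shape
  \<open>\<Sum>\<^sub>i\<^sub>j l\<^sub>i\<^sub>j x\<^sub>i x\<^sub>j\<^sup>3\<close> with zero diagonal and zero row sums, so these quartics form a space of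
  dimension at most 8 and the expected dimension is \<open>- 1\<close>. The second derivatives at \<open>R\<close> vanish if
  \<open>l\<^sub>i\<^sub>j = R\<^sub>i\<^sup>2 \<mu>\<^sub>i\<^sub>j\<close> with \<open>\<mu>\<close> antisymmetric and annihilating \<open>(R\<^sub>j\<^sup>3)\<^sub>j\<close>; the row sums vanish
  if \<open>\<mu>\<close> also annihilates \<open>(1, 1, 1, 1)\<close>. In dimension 4 the Hodge dual of the wedge product of these
  two vectors is such a \<open>\<mu>\<close>, and it is nonzero unless \<open>R\<close> is proportional to a point whose coordinates
  are cube roots of unity, up to degenerate cases that are settled by the factors \<open>R\<^sub>i\<^sup>2\<close>. The second
  derivatives at the twisted point \<open>R\<^sub>a\<close> only involve the row \<open>a\<close> of \<open>\<mu>\<close>.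
\<close>

section \<open>Evaluation and formal partial derivatives of polynomials\<close>

lemma evalp_superset:
  assumes "finite A" "Poly_Mapping.keys p \<subseteq> A"
  shows "evalp p v = (\<Sum>t\<in>A. Poly_Mapping.lookup p t * (\<Prod>i\<in>UNIV. v i ^ Poly_Mapping.lookup t i))"
  unfolding evalp_def
  by (rule sum.mono_neutral_left) (use assms in \<open>auto simp: in_keys_iff\<close>)

lemma evalp_0 [simp]: "evalp 0 v = 0"
  by (simp add: evalp_def)

lemma evalp_add: "evalp (p + q) v = evalp p v + evalp q v"
proof -
  let ?A = "Poly_Mapping.keys p \<union> Poly_Mapping.keys q"
  have "Poly_Mapping.keys (p + q) \<subseteq> ?A"
    by (rule Poly_Mapping.keys_add)
  then show ?thesis
    by (simp add: evalp_superset[of ?A] lookup_add algebra_simps sum.distrib)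
qed

lemma evalp_sum: "evalp (sum f A) v = (\<Sum>a\<in>A. evalp (f a) v)"
  by (induction A rule: infinite_finite_induct) (simp_all add: evalp_add)

lemma evalp_single:
  "evalp (Poly_Mapping.single t c) v = c * (\<Prod>i\<in>UNIV. v i ^ Poly_Mapping.lookup t i)"
  by (subst evalp_superset[of "{t}"]) auto

lemma pdiff_superset:
  assumes "finite A" "Poly_Mapping.keys p \<subseteq> A"
  shows "pdiff i p = (\<Sum>t\<in>A. Poly_Mapping.single (t - Poly_Mapping.single i 1)
           (of_nat (Poly_Mapping.lookup t i) * Poly_Mapping.lookup p t))"
  unfolding pdiff_def
  by (rule sum.mono_neutral_left) (use assms in \<open>auto simp: in_keys_iff\<close>)

lemma pdiff_0 [simp]: "pdiff i 0 = 0"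
  by (simp add: pdiff_def)

lemma pdiff_add: "pdiff i (p + q) = pdiff i p + pdiff i q"
proof -
  let ?A = "Poly_Mapping.keys p \<union> Poly_Mapping.keys q"
  have "Poly_Mapping.keys (p + q) \<subseteq> ?A"
    by (rule Poly_Mapping.keys_add)
  then show ?thesis
    by (simp add: pdiff_superset[of ?A] lookup_add algebra_simps sum.distrib single_add)
qed

lemma pdiff_sum: "pdiff i (sum f A) = (\<Sum>a\<in>A. pdiff i (f a))"
  by (induction A rule: infinite_finite_induct) (simp_all add: pdiff_add)

lemma pdiff_single:
  "pdiff i (Poly_Mapping.single t c) =
     Poly_Mapping.single (t - Poly_Mapping.single i 1) (of_nat (Poly_Mapping.lookup t i) * c)"
  by (subst pdiff_superset[of "{t}"]) auto

text \<open>The exponent vector of \<open>x\<^sub>i x\<^sub>j\<^sup>n\<close>.\<close>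

definition mon :: "'i \<Rightarrow> 'i \<Rightarrow> nat \<Rightarrow> 'i \<Rightarrow>\<^sub>0 nat" where
  "mon i j n = Poly_Mapping.single i 1 + Poly_Mapping.single j n"

lemma lookup_mon:
  "Poly_Mapping.lookup (mon i j n) k = (if k = i then 1 else 0) + (if k = j then n else 0)"
  by (auto simp: mon_def lookup_add lookup_single when_def)

text \<open>The variable with exponent at least 3 determines \<open>j\<close>, and what remains
  determines \<open>i\<close>; for \<open>i = j\<close> the monomial is a fourth power. So a quartic
  in these monomials has well-defined coefficients.\<close>

lemma mon_3_eq_iff: "mon i j 3 = mon i' j' 3 \<longleftrightarrow> i = i' \<and> j = j'"
proof
  assume eq: "mon i j 3 = mon i' j' 3"
  have "Poly_Mapping.lookup (mon i j 3) k = Poly_Mapping.lookup (mon i' j' 3) k" for k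
    using eq by simp
  from this[of i] this[of j] show "i = i' \<and> j = j'"
    by (auto simp: lookup_mon split: if_splits)
qed auto

lemma evalp_single_single:
  "evalp (Poly_Mapping.single (Poly_Mapping.single i n) c) v = c * v i ^ n"
proof -
  have "(\<Prod>k\<in>UNIV. v k ^ Poly_Mapping.lookup (Poly_Mapping.single i n) k)
      = (\<Prod>k\<in>UNIV. if k = i then v k ^ n else 1)"
    by (rule prod.cong) (auto simp: lookup_single when_def)
  then show ?thesis by (simp add: evalp_single)
qed

lemma evalp_mon: "evalp (Poly_Mapping.single (mon i j n) c) v = c * v i * v j ^ n"
proof -
  have "(\<Prod>k\<in>UNIV. v k ^ Poly_Mapping.lookup (mon i j n) k)
      = (\<Prod>k\<in>UNIV. if k = i then v k else 1) * (\<Prod>k\<in>UNIV. if k = j then v k ^ n else 1)"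
    unfolding prod.distrib[symmetric] by (rule prod.cong) (auto simp: lookup_mon power_add)
  then show ?thesis by (simp add: evalp_single)
qed

lemma pdiff_single_single:
  "pdiff k (Poly_Mapping.single (Poly_Mapping.single j (Suc n)) c) =
     (if k = j then Poly_Mapping.single (Poly_Mapping.single j n) (of_nat (Suc n) * c) else 0)"
  by (auto simp: pdiff_single lookup_single when_def simp flip: single_diff)

lemma pdiff_mon:
  "pdiff k (Poly_Mapping.single (mon i j (Suc n)) c) =
     (if k = i then Poly_Mapping.single (Poly_Mapping.single j (Suc n)) c else 0) +
     (if k = j then Poly_Mapping.single (mon i j n) (of_nat (Suc n) * c) else 0)"
proof -
  have i: "mon i j (Suc n) - Poly_Mapping.single i 1 = Poly_Mapping.single j (Suc n)"
    by (simp add: mon_def)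
  have "Poly_Mapping.single j (Suc n) = Poly_Mapping.single j 1 + Poly_Mapping.single j n"
    by (simp flip: single_add)
  then have j: "mon i j (Suc n) - Poly_Mapping.single j 1 = mon i j n"
    by (simp add: mon_def add.left_commute[of "Poly_Mapping.single i _"])
  show ?thesis
  \<comment> \<open>For \<open>i = j\<close> both terms of the product rule are multiples of the
    same monomial and their coefficients add up.\<close>
  proof (cases "k = i \<and> k = j")
    case True
    have "mon j j n = Poly_Mapping.single j (Suc n)"
      by (simp add: mon_def flip: single_add)
    with True i show ?thesis
      by (simp add: pdiff_single lookup_mon algebra_simps flip: single_add)
  next
    case False
    then show ?thesis
      unfolding pdiff_single lookup_mon using i j by auto
  qed
qed

lemma evalp_pdiff_mon:
  "evalp (pdiff k (Poly_Mapping.single (mon i j 3) c)) v =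
     (if k = i then c * v j ^ 3 else 0) + (if k = j then 3 * c * v i * v j ^ 2 else 0)"
  using pdiff_mon[of k i j 2 c] by (simp add: evalp_add evalp_single_single evalp_mon)

lemma evalp_pdiff2_mon:
  "evalp (pdiff m (pdiff k (Poly_Mapping.single (mon i j 3) c))) v =
     (if k = i \<and> m = j then 3 * c * v j ^ 2 else 0) +
     (if k = j \<and> m = i then 3 * c * v j ^ 2 else 0) +
     (if k = j \<and> m = j then 6 * c * v i * v j else 0)"
proof -
  have k: "pdiff k (Poly_Mapping.single (mon i j 3) c) =
      (if k = i then Poly_Mapping.single (Poly_Mapping.single j 3) c else 0) +
      (if k = j then Poly_Mapping.single (mon i j 2) (3 * c) else 0)"
    using pdiff_mon[of k i j 2 c] by simp
  have m3: "pdiff m (Poly_Mapping.single (Poly_Mapping.single j 3) c) =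
      (if m = j then Poly_Mapping.single (Poly_Mapping.single j 2) (3 * c) else 0)"
    using pdiff_single_single[of m j 2 c] by simp
  have m2: "pdiff m (Poly_Mapping.single (mon i j 2) (3 * c)) =
      (if m = i then Poly_Mapping.single (Poly_Mapping.single j 2) (3 * c) else 0) +
      (if m = j then Poly_Mapping.single (mon i j 1) (6 * c) else 0)"
    using pdiff_mon[of m i j 1 "3 * c"] by (simp add: numeral_2_eq_2)
  show ?thesis
    by (auto simp only: k m3 m2 pdiff_add pdiff_0 evalp_add evalp_0 evalp_single_single evalp_mon
        split: if_splits) auto
qed

section \<open>Quartics in the monomials \<open>x_i x_j^3\<close> and their derivatives\<close>

definition quartic13 :: "('i::finite \<Rightarrow> 'i \<Rightarrow> complex) \<Rightarrow> 'i cpoly" where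
  "quartic13 l = (\<Sum>i\<in>UNIV. \<Sum>j\<in>UNIV. Poly_Mapping.single (mon i j 3) (l i j))"

lemma lookup_quartic13: 
  "Poly_Mapping.lookup (quartic13 l) t = (\<Sum>i\<in>UNIV. \<Sum>j\<in>UNIV. if mon i j 3 = t then l i j else 0)"
  by (simp add: quartic13_def lookup_sum lookup_single when_def)

lemma lookup_quartic13_mon: "Poly_Mapping.lookup (quartic13 l) (mon i j 3) = l i j"
proof -
  have "Poly_Mapping.lookup (quartic13 l) (mon i j 3)
     = (\<Sum>i'\<in>UNIV. if i' = i then \<Sum>j'\<in>UNIV. if j' = j then l i' j' else 0 else 0)"
    unfolding lookup_quartic13 by (intro sum.cong) (auto simp: mon_3_eq_iff)
  then show ?thesis by simp
qed

lemma is_form_quartic13: "is_form 4 (quartic13 l)"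
proof -
  have "(\<Sum>k\<in>UNIV. Poly_Mapping.lookup t k) = 4"
    if "t \<in> Poly_Mapping.keys (quartic13 l)" for t
  proof -
    have "\<exists>i j. t = mon i j 3"
    proof (rule ccontr)
      assume "\<not> ?thesis"
      then have "Poly_Mapping.lookup (quartic13 l) t = 0"
        unfolding lookup_quartic13 by (intro sum.neutral ballI) auto
      with that show False by (simp add: in_keys_iff)
    qed
    then obtain i j where "t = mon i j 3" by blast
    then show ?thesis
      by (simp add: lookup_mon sum.distrib)
  qed
  then show ?thesis by (simp add: is_form_def)
qed

lemma evalp_quartic13: "evalp (quartic13 l) v = (\<Sum>i\<in>UNIV. v i * (\<Sum>j\<in>UNIV. l i j * v j ^ 3))"
  by (simp add: quartic13_def evalp_sum evalp_mon sum_distrib_left algebra_simps)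

lemma evalp_pdiff_quartic13:
  "evalp (pdiff k (quartic13 l)) v =
     (\<Sum>j\<in>UNIV. l k j * v j ^ 3) + 3 * v k ^ 2 * (\<Sum>i\<in>UNIV. l i k * v i)"
proof -
  have "evalp (pdiff k (quartic13 l)) v =
      (\<Sum>i\<in>UNIV. if k = i then \<Sum>j\<in>UNIV. l i j * v j ^ 3 else 0) +
      (\<Sum>i\<in>UNIV. \<Sum>j\<in>UNIV. if k = j then 3 * l i j * v i * v j ^ 2 else 0)"
    unfolding quartic13_def pdiff_sum evalp_sum evalp_pdiff_mon sum.distrib
    by (intro arg_cong2[of _ _ _ _ "(+)"] sum.cong refl) auto
  then show ?thesis
    by (simp add: sum_distrib_left algebra_simps)
qed

lemma evalp_pdiff2_quartic13:
  "evalp (pdiff m (pdiff k (quartic13 l))) v =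
     3 * l k m * v m ^ 2 + 3 * l m k * v k ^ 2 +
     (if m = k then 6 * v k * (\<Sum>i\<in>UNIV. l i k * v i) else 0)"
proof -
  have "evalp (pdiff m (pdiff k (quartic13 l))) v =
      (\<Sum>i\<in>UNIV. if k = i then \<Sum>j\<in>UNIV. if m = j then 3 * l i j * v j ^ 2 else 0 else 0) +
      (\<Sum>i\<in>UNIV. if m = i then \<Sum>j\<in>UNIV. if k = j then 3 * l i j * v j ^ 2 else 0 else 0) +
      (\<Sum>i\<in>UNIV. \<Sum>j\<in>UNIV. if k = j then if m = j then 6 * l i j * v i * v j else 0 else 0)"
    unfolding quartic13_def pdiff_sum evalp_sum evalp_pdiff2_mon sum.distrib
    by (intro arg_cong2[of _ _ _ _ "(+)"] sum.cong refl) auto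
  then show ?thesis
    by (simp add: sum_distrib_left algebra_simps)
qed

lemma vanishes_to_order_2_iff:
  "vanishes_to_order 2 p v \<longleftrightarrow> vanishes_at p v \<and> (\<forall>k. vanishes_at (pdiff k p) v)"
proof -
  have "length is < 2 \<longleftrightarrow> is = [] \<or> (\<exists>k. is = [k])" for "is" :: "'a list"
    by (cases "is") (auto simp: length_Suc_conv)
  then show ?thesis
    unfolding vanishes_to_order_def by auto
qed

lemma vanishes_to_order_3_iff:
  "vanishes_to_order 3 p v \<longleftrightarrow>
     vanishes_to_order 2 p v \<and> (\<forall>k m. vanishes_at (pdiff m (pdiff k p)) v)"
proof -
  have *: "length is < 3 \<longleftrightarrow> length is < 2 \<or> (\<exists>k m. is = [k, m])" for "is" :: "'a list"
  proof -
    have "length is < 3 \<longleftrightarrow> length is < 2 \<or> length is = Suc (Suc 0)" by linarith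
    then show ?thesis by (simp only: length_Suc_conv) auto
  qed
  show ?thesis
    unfolding vanishes_to_order_def * by (auto 0 3)
qed


lemma vanishes_at_quartic13_axis: "vanishes_at (quartic13 l) (axis a 1) \<longleftrightarrow> l a a = 0"
proof -
  have 1: "axis a 1 $ i * x = (if i = a then x else 0)" for i and x :: complex
    by (simp add: axis_def)
  have 3: "x * axis a 1 $ j ^ 3 = (if j = a then x else 0)" for j and x :: complex
    by (simp add: axis_def)
  have "evalp (quartic13 l) (($) (axis a 1)) = l a a"
    unfolding evalp_quartic13 1 3 by simp
  then show ?thesis by (simp add: vanishes_at_def)
qed

text \<open>On cube roots of unity every inner sum of the evaluation formula collapses to a row sum
  of \<open>l\<close>.\<close>

lemma vanishes_at_quartic13_roots_of_unity:
  assumes "\<And>i. (\<Sum>j\<in>UNIV. l i j) = 0" "\<And>i. v $ i ^ 3 = 1"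
  shows "vanishes_at (quartic13 l) v"
  using assms by (simp add: vanishes_at_def evalp_quartic13)

section \<open>Triple and double points from an antisymmetric matrix\<close>

context
  fixes R :: "complex^'n::finite" and \<mu> :: "'n \<Rightarrow> 'n \<Rightarrow> complex"
  assumes anti: "\<And>i j. \<mu> j i = - \<mu> i j"
    and ker: "\<And>i. (\<Sum>j\<in>UNIV. \<mu> i j * R $ j ^ 3) = 0"
begin

text \<open>The weight makes \<open>l i j * R $ j ^ 2\<close> antisymmetric, and it turns the one
  kernel condition on \<mu> into both \<open>row_sum\<close> and \<open>col_sum\<close>, the sums
  that occur in the derivatives at \<open>R\<close>.\<close>

private definition "l i j = R $ i ^ 2 * \<mu> i j"

private lemma row_sum: "(\<Sum>j\<in>UNIV. l k j * R $ j ^ 3) = 0"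
  using ker[of k] by (simp add: l_def mult.assoc flip: sum_distrib_left)

private lemma col_sum: "(\<Sum>i\<in>UNIV. l i k * R $ i) = 0"
proof -
  have "(\<Sum>i\<in>UNIV. l i k * R $ i) = (\<Sum>i\<in>UNIV. - (\<mu> k i * R $ i ^ 3))"
  proof (rule sum.cong)
    fix i show "l i k * R $ i = - (\<mu> k i * R $ i ^ 3)"
      using anti[of i k] by (simp add: l_def power2_eq_square power3_eq_cube)
  qed simp
  with ker[of k] show ?thesis by (simp add: sum_negf)
qed

text \<open>Only summand \<open>a\<close> changes: \<open>(-2)^3 - 1 = -9\<close> times its old
  value is added. For the column sums below the factor is \<open>-2 - 1 = -3\<close>.\<close>

private lemma row_sum_twist: "(\<Sum>j\<in>UNIV. l k j * twist a R $ j ^ 3) = - 9 * l k a * R $ a ^ 3"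
proof -
  have "(\<Sum>j\<in>UNIV. l k j * twist a R $ j ^ 3) =
      (\<Sum>j\<in>UNIV. l k j * R $ j ^ 3 + (if j = a then - 9 * l k j * R $ j ^ 3 else 0))"
    by (rule sum.cong) (auto simp: twist_def power_mult_distrib)
  with row_sum[of k] show ?thesis by (simp add: sum.distrib)
qed

private lemma col_sum_twist: "(\<Sum>i\<in>UNIV. l i k * twist a R $ i) = - 3 * l a k * R $ a"
proof -
  have "(\<Sum>i\<in>UNIV. l i k * twist a R $ i) =
      (\<Sum>i\<in>UNIV. l i k * R $ i + (if i = a then - 3 * l i k * R $ i else 0))"
    by (rule sum.cong) (auto simp: twist_def)
  with col_sum[of k] show ?thesis by (simp add: sum.distrib)
qed

text \<open>Value and first derivatives vanish by the row and column sums. The second derivatives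
  combine a column sum with \<open>l k m * R $ m ^ 2 + l m k * R $ k ^ 2\<close>, which is zero by
  antisymmetry.\<close>

lemma quartic13_triple_point: "vanishes_to_order 3 (quartic13 (\<lambda>i j. R $ i ^ 2 * \<mu> i j)) R"
proof -
  have "l k m * R $ m ^ 2 + l m k * R $ k ^ 2 = 0" for k m
    using anti[of k m] by (simp add: l_def algebra_simps)
  then have "3 * l k m * R $ m ^ 2 + 3 * l m k * R $ k ^ 2 = 0" for k m
    by (metis (no_types, opaque_lifting) distrib_left mult.assoc mult_zero_right)
  then have "vanishes_to_order 3 (quartic13 l) R"
    by (simp add: vanishes_to_order_3_iff vanishes_to_order_2_iff vanishes_at_def evalp_quartic13
        evalp_pdiff_quartic13 evalp_pdiff2_quartic13 row_sum col_sum)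
  then show ?thesis by (simp add: l_def [abs_def])
qed

text \<open>This is where the factor -2 comes from: with \<open>c\<close> in its place, the
  derivative in a direction \<open>k \<noteq> a\<close> is a multiple of
  \<open>c^3 - 1 - 3 * (c - 1) = (c - 1)^2 * (c + 2)\<close>. The value and the derivative in
  direction \<open>a\<close> vanish because \<mu> has zero diagonal.\<close>

lemma quartic13_singular_twist: "singular_at (quartic13 (\<lambda>i j. R $ i ^ 2 * \<mu> i j)) (twist a R)"
proof -
  have aa: "\<mu> a a = 0"
    using anti[of a a] by simp
  have "(\<Sum>i\<in>UNIV. twist a R $ i * (- 9 * l i a * R $ a ^ 3)) =
      - 9 * R $ a ^ 3 * (\<Sum>i\<in>UNIV. l i a * twist a R $ i)"
    by (simp add: sum_distrib_left algebra_simps)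
  also have "\<dots> = 0"
    by (simp only: col_sum_twist) (simp add: l_def aa)
  finally have 0: "vanishes_at (quartic13 l) (twist a R)"
    by (simp add: vanishes_at_def evalp_quartic13 row_sum_twist)
  have "- 9 * l k a * R $ a ^ 3 + 3 * twist a R $ k ^ 2 * (- 3 * l a k * R $ a) = 0" for k
    using anti[of k a] aa
    by (cases "k = a") (simp_all add: l_def twist_def algebra_simps power2_eq_square power3_eq_cube)
  with 0 have "vanishes_to_order 2 (quartic13 l) (twist a R)"
    unfolding vanishes_to_order_2_iff
    by (simp add: vanishes_at_def evalp_pdiff_quartic13 row_sum_twist col_sum_twist)
  then show ?thesis by (simp add: singular_at_def l_def [abs_def])
qed

text \<open>Of the two terms that cancel in a mixed second derivative at \<open>R\<close>, the twist
  scales only one, by \<open>(-2)^2 = 4\<close>, so they no longer cancel.\<close>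

lemma quartic13_triple_twist:
  assumes "vanishes_to_order 3 (quartic13 (\<lambda>i j. R $ i ^ 2 * \<mu> i j)) (twist a R)" "R $ a \<noteq> 0"
  shows "R $ m * \<mu> a m = 0"
proof (cases "m = a")
  case True
  then show ?thesis using anti[of a a] by simp
next
  case False
  from assms have "evalp (pdiff m (pdiff a (quartic13 l))) (($) (twist a R)) = 0"
    by (simp add: vanishes_to_order_3_iff vanishes_at_def l_def [abs_def])
  with False have "- 9 * (R $ a ^ 2 * R $ m ^ 2 * \<mu> a m) = 0"
    using anti[of a m]
    by (simp add: evalp_pdiff2_quartic13 twist_def l_def power_mult_distrib algebra_simps)
  with assms show ?thesis by simp
qed

end

section \<open>The Hodge dual of the wedge product of (1, 1, 1, 1) and \<open>v\<close>\<close>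

lemma vector_4:
  "(vector [x, y, z, w] :: 'a::zero^4) $ 1 = x"
  "(vector [x, y, z, w] :: 'a::zero^4) $ 2 = y"
  "(vector [x, y, z, w] :: 'a::zero^4) $ 3 = z"
  "(vector [x, y, z, w] :: 'a::zero^4) $ 4 = w"
  unfolding vector_def by simp_all

text \<open>The entries are \<open>\<Sum>\<^sub>k\<^sub>l \<epsilon>\<^sub>i\<^sub>j\<^sub>k\<^sub>l v\<^sub>l\<close>, where \<open>\<epsilon>\<close> is the Levi-Civita symbol.\<close>

definition mu :: "complex^4 \<Rightarrow> 4 \<Rightarrow> 4 \<Rightarrow> complex" where
  "mu v i j = (vector
    [vector [0, v$4 - v$3, v$2 - v$4, v$3 - v$2],
     vector [v$3 - v$4, 0, v$4 - v$1, v$1 - v$3],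
     vector [v$4 - v$2, v$1 - v$4, 0, v$2 - v$1],
     vector [v$2 - v$3, v$3 - v$1, v$1 - v$2, 0]] :: complex^4^4) $ i $ j"

lemma mu_anti: "mu v j i = - mu v i j"
  using exhaust_4[of i] exhaust_4[of j] by (auto simp: mu_def vector_4)

lemma mu_sum: "(\<Sum>j\<in>UNIV. mu v i j) = 0"
  using exhaust_4[of i] by (auto simp: mu_def vector_4 sum_4)

lemma mu_ker: "(\<Sum>j\<in>UNIV. mu v i j * v $ j) = 0"
  using exhaust_4[of i] by (auto simp: mu_def vector_4 sum_4 algebra_simps)

text \<open>Up to sign, the off-diagonal entries of row \<open>a\<close> are the pairwise
  differences of the other three coordinates.\<close>

lemma mu_eq_zero_imp_eq:
  assumes "\<And>j. mu v a j = 0" "j \<noteq> a" "k \<noteq> a"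
  shows "v $ j = v $ k"
proof -
  have "\<forall>j. mu v a j = 0" using assms by blast
  then show ?thesis
    using exhaust_4[of a] exhaust_4[of j] exhaust_4[of k] assms(2,3)
    by (auto simp: mu_def vector_4 forall_4)
qed

text \<open>Each nonzero coordinate forces the other three to agree. If \<open>a\<close> and
  \<open>b\<close> are two such indices, their rows share a further index \<open>d\<close>, through
  which all coordinates become equal.\<close>

lemma mu_all_zero:
  assumes "\<And>i j. v $ i * mu v i j = 0" "v $ a \<noteq> 0"
  shows "(\<forall>j. j \<noteq> a \<longrightarrow> v $ j = 0) \<or> (\<forall>j. v $ j = v $ a)"
proof (rule disjCI)
  assume "\<not> (\<forall>j. v $ j = v $ a)"
  then obtain c where c: "v $ c \<noteq> v $ a" by blast
  have row: "v $ j = v $ k" if "v $ i \<noteq> 0" "j \<noteq> i" "k \<noteq> i" for i j k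
    using mu_eq_zero_imp_eq[of v i j k] assms(1)[of i] that by auto
  show "\<forall>j. j \<noteq> a \<longrightarrow> v $ j = 0"
  proof (rule ccontr)
    assume "\<not> ?thesis"
    then obtain b where b: "b \<noteq> a" "v $ b \<noteq> 0" by blast
    with row[OF assms(2)] c have "v $ c = v $ b" by metis
    have "\<exists>d. d \<noteq> a \<and> d \<noteq> b"
      using exhaust_4[of a] exhaust_4[of b] by (auto intro: exI[of _ 1] exI[of _ 2] exI[of _ 3])
    then obtain d where "d \<noteq> a" "d \<noteq> b" by blast
    with row[OF assms(2), of b d] row[of b a d] b \<open>v $ c = v $ b\<close> c show False by auto
  qed
qed

text \<open>Off \<open>a\<close>, each condition is a coordinate times the difference of the other
  two. As \<open>v $ b\<close> is nonzero, the remaining two coordinates agree; if they are nonzero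
  as well, they also equal \<open>v $ b\<close>.\<close>

lemma mu_row_zero:
  assumes "\<And>j. v $ j * mu v a j = 0" "b \<noteq> a" "v $ b \<noteq> 0"
  shows "(\<forall>j. j \<noteq> a \<and> j \<noteq> b \<longrightarrow> v $ j = 0) \<or> (\<forall>j. j \<noteq> a \<longrightarrow> v $ j = v $ b)"
proof -
  have "\<forall>j. v $ j * mu v a j = 0" using assms by blast
  then show ?thesis
    using exhaust_4[of a] exhaust_4[of b] assms(2,3) by (auto simp: mu_def vector_4 forall_4)
qed

section \<open>Cube roots of unity, Fermat points and twisted points\<close>

lemma cube_roots_of_unity:
  assumes "primitive_cube_root \<epsilon>"
  shows "{z. z ^ 3 = 1} = {1, \<epsilon>, \<epsilon> ^ 2}" "\<epsilon> \<noteq> 1" "\<epsilon> ^ 2 \<noteq> 1" "\<epsilon> \<noteq> \<epsilon> ^ 2" "1 + \<epsilon> + \<epsilon> ^ 2 = 0"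
proof -
  from assms have 3: "\<epsilon> ^ 3 = 1" and ne: "\<epsilon> \<noteq> 1" and ne2: "\<epsilon> ^ 2 \<noteq> 1"
    by (simp_all add: primitive_cube_root_def)
  have "(\<epsilon> - 1) * (1 + \<epsilon> + \<epsilon> ^ 2) = 0"
    using 3 by (simp add: algebra_simps power2_eq_square power3_eq_cube)
  with ne show 0: "1 + \<epsilon> + \<epsilon> ^ 2 = 0" by simp
  have "z ^ 3 = 1 \<longleftrightarrow> (z - 1) * (z - \<epsilon>) * (z - \<epsilon> ^ 2) = 0" for z
  proof -
    have "(z - 1) * (z - \<epsilon>) * (z - \<epsilon> ^ 2) =
        z ^ 3 - (1 + \<epsilon> + \<epsilon> ^ 2) * z ^ 2 + \<epsilon> * (1 + \<epsilon> + \<epsilon> ^ 2) * z - \<epsilon> ^ 3"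
      by (simp add: algebra_simps power2_eq_square power3_eq_cube)
    then show ?thesis by (simp add: 0 3)
  qed
  then show "{z. z ^ 3 = 1} = {1, \<epsilon>, \<epsilon> ^ 2}" by auto
  show "\<epsilon> \<noteq> 1" "\<epsilon> ^ 2 \<noteq> 1" by fact+
  show "\<epsilon> \<noteq> \<epsilon> ^ 2"
    using ne 3 by (auto simp: power2_eq_square power3_eq_cube)
qed

lemma fermat_points_iff:
  assumes "primitive_cube_root \<epsilon>"
  shows "P \<in> fermat_points \<epsilon> \<longleftrightarrow> (P $ 1 = 1 \<and> (\<forall>i. P $ i ^ 3 = 1)) \<or> (\<exists>a. P = axis a 1)"
proof -
  have 3: "\<epsilon> ^ 3 = 1" using assms by (simp add: primitive_cube_root_def)
  have pow: "(\<exists>k\<in>{1..3}. z = \<epsilon> ^ k) \<longleftrightarrow> z ^ 3 = 1" for z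
  proof -
    \<comment> \<open>The exponent 3 contributes the root 1.\<close>
    have "{1..3::nat} = {1, 2, 3}" by auto
    then have "(\<exists>k\<in>{1..3}. z = \<epsilon> ^ k) \<longleftrightarrow> z \<in> {1, \<epsilon>, \<epsilon> ^ 2}" using 3 by auto
    then show ?thesis using cube_roots_of_unity(1)[OF assms] by blast
  qed
  have "(\<exists>\<alpha> \<beta> \<gamma>. P = vector [1, \<epsilon> ^ \<alpha>, \<epsilon> ^ \<beta>, \<epsilon> ^ \<gamma>] \<and> \<alpha> \<in> {1..3} \<and> \<beta> \<in> {1..3} \<and> \<gamma> \<in> {1..3})
      \<longleftrightarrow> P $ 1 = 1 \<and> (\<exists>k\<in>{1..3}. P $ 2 = \<epsilon> ^ k) \<and> (\<exists>k\<in>{1..3}. P $ 3 = \<epsilon> ^ k)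
        \<and> (\<exists>k\<in>{1..3}. P $ 4 = \<epsilon> ^ k)"
    unfolding vec_eq_iff forall_4 vector_4 by blast
  also have "\<dots> \<longleftrightarrow> P $ 1 = 1 \<and> (\<forall>i. P $ i ^ 3 = 1)"
    unfolding pow by (auto simp: forall_4)
  finally have 27: "(\<exists>\<alpha> \<beta> \<gamma>. P = vector [1, \<epsilon> ^ \<alpha>, \<epsilon> ^ \<beta>, \<epsilon> ^ \<gamma>] \<and>
      \<alpha> \<in> {1..3} \<and> \<beta> \<in> {1..3} \<and> \<gamma> \<in> {1..3}) \<longleftrightarrow> P $ 1 = 1 \<and> (\<forall>i. P $ i ^ 3 = 1)" .
  have axes: "axis 1 1 = (vector [1, 0, 0, 0] :: complex^4)" "axis 2 1 = (vector [0, 1, 0, 0] :: complex^4)"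
    "axis 3 1 = (vector [0, 0, 1, 0] :: complex^4)" "axis 4 1 = (vector [0, 0, 0, 1] :: complex^4)"
    by (simp_all add: vec_eq_iff forall_4 vector_4 axis_def)
  have "(\<exists>a. P = axis a 1) \<longleftrightarrow>
      P \<in> {vector [1, 0, 0, 0], vector [0, 1, 0, 0], vector [0, 0, 1, 0], vector [0, 0, 0, 1]}"
    unfolding axes[symmetric] by (simp only: insert_iff empty_iff) (metis exhaust_4)
  with 27 show ?thesis unfolding fermat_points_def by blast
qed

lemma ex_nonzero_off_axis:
  assumes "R \<noteq> 0" "\<not> proj_eq (axis a 1) R"
  shows "\<exists>b. b \<noteq> a \<and> R $ b \<noteq> 0"
proof (rule ccontr)
  assume "\<not> ?thesis"
  then have "R = R $ a *s axis a 1"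
    by (auto simp: vec_eq_iff axis_def)
  moreover from this \<open>R \<noteq> 0\<close> have "R $ a \<noteq> 0"
    by auto
  ultimately show False
    using assms(2) unfolding proj_eq_def by blast
qed

lemma not_proj_eq_twist:
  assumes "R $ i \<noteq> 0" "b \<noteq> i" "R $ b \<noteq> 0"
  shows "\<not> proj_eq R (twist i R)" "j \<noteq> i \<Longrightarrow> \<not> proj_eq (twist i R) (twist j R)"
proof -
  show "\<not> proj_eq R (twist i R)"
  proof
    assume "proj_eq R (twist i R)"
    then obtain c where c: "\<And>k. twist i R $ k = c * R $ k"
      by (auto simp: proj_eq_def vec_eq_iff)
    from c[of i] c[of b] assms show False by (simp add: twist_def)
  qed
  assume "j \<noteq> i"
  show "\<not> proj_eq (twist i R) (twist j R)"
  proof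
    assume "proj_eq (twist i R) (twist j R)"
    then obtain c where c: "\<And>k. twist j R $ k = c * twist i R $ k"
      by (auto simp: proj_eq_def vec_eq_iff)
    \<comment> \<open>Coordinate \<open>i\<close> forces \<open>c = -1/2\<close>. Coordinate
      \<open>j\<close> then gives \<open>-2 * R $ j = - R $ j / 2\<close>, so
      \<open>R $ j = 0\<close>, and coordinate \<open>b\<close> yields
      \<open>R $ b = 0\<close>.\<close>
    have "R $ i * (c * (- 2)) = R $ i * 1"
      using c[of i, symmetric] \<open>j \<noteq> i\<close> by (simp add: twist_def algebra_simps)
    with assms(1) have "c * (- 2) = 1"
      by (simp only: mult_cancel_left simp_thms)
    then have c2: "c = 1 / (- 2)"
      by (subst nonzero_eq_divide_eq) simp_all
    have "R $ j = 0"
      using c[of j] \<open>j \<noteq> i\<close> by (simp add: twist_def c2 field_simps)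
    then have "R $ b = 0"
      using c[of b] assms(2) by (cases "b = j") (simp_all add: twist_def c2 field_simps)
    with assms(3) show False by simp
  qed
qed

section \<open>The quartic attached to a point \<open>R\<close>\<close>

definition mu_quartic :: "complex^4 \<Rightarrow> 4 cpoly" where
  "mu_quartic R = quartic13 (\<lambda>i j. R $ i ^ 2 * mu (\<chi> k. R $ k ^ 3) i j)"

lemma mu_quartic_properties:
  shows "is_form 4 (mu_quartic R)"
    and "vanishes_to_order 3 (mu_quartic R) R"
    and "singular_at (mu_quartic R) (twist a R)"
    and "vanishes_to_order 3 (mu_quartic R) (twist a R) \<Longrightarrow> R $ a \<noteq> 0 \<Longrightarrow>
      R $ m * mu (\<chi> k. R $ k ^ 3) a m = 0"
proof -
  \<comment> \<open>The kernel condition concerns the cubes of the coordinates, which is why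
    \<open>mu\<close> is built from them.\<close>
  have ker: "(\<Sum>j\<in>UNIV. mu (\<chi> k. R $ k ^ 3) i j * R $ j ^ 3) = 0" for i
    using mu_ker[of "\<chi> k. R $ k ^ 3" i] by simp
  show "is_form 4 (mu_quartic R)"
    by (simp add: mu_quartic_def is_form_quartic13)
  show "vanishes_to_order 3 (mu_quartic R) R"
    unfolding mu_quartic_def by (rule quartic13_triple_point) (rule mu_anti, rule ker)
  show "singular_at (mu_quartic R) (twist a R)"
    unfolding mu_quartic_def by (rule quartic13_singular_twist) (rule mu_anti, rule ker)
  show "R $ m * mu (\<chi> k. R $ k ^ 3) a m = 0"
    if "vanishes_to_order 3 (mu_quartic R) (twist a R)" "R $ a \<noteq> 0"
    using quartic13_triple_twist[OF mu_anti ker that[unfolded mu_quartic_def]] .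
qed

context
  fixes \<epsilon> :: complex and R :: "complex^4"
  assumes prim: "primitive_cube_root \<epsilon>"
begin

lemma mu_quartic_vanishes_at_fermat:
  assumes "P \<in> fermat_points \<epsilon>"
  shows "vanishes_at (mu_quartic R) P"
  using assms unfolding fermat_points_iff[OF prim]
proof (elim disjE exE conjE)
  assume "\<forall>i. P $ i ^ 3 = 1"
  then show ?thesis
    unfolding mu_quartic_def
    by (intro vanishes_at_quartic13_roots_of_unity) (simp_all add: mu_sum flip: sum_distrib_left)
next
  fix a assume "P = axis a 1"
  with mu_anti[of "\<chi> k. R $ k ^ 3" a a] show ?thesis
    by (simp add: mu_quartic_def vanishes_at_quartic13_axis)
qed

text \<open>If all coefficients vanish, the vector of cubes is supported on one coordinate or
  constant. Then \<open>R\<close> is proportional to a coordinate point or to a vector of cube roots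
  of unity, hence to a Fermat point.\<close>

lemma mu_quartic_nonzero:
  assumes "R \<noteq> 0" and off: "\<And>P. P \<in> fermat_points \<epsilon> \<Longrightarrow> \<not> proj_eq P R"
  shows "mu_quartic R \<noteq> 0"
proof
  assume 0: "mu_quartic R = 0"
  let ?v = "\<chi> k. R $ k ^ 3"
  have "R $ i ^ 2 * mu ?v i j = 0" for i j
    using lookup_quartic13_mon[of "\<lambda>i j. R $ i ^ 2 * mu ?v i j" i j] 0
    by (simp add: mu_quartic_def)
  then have v: "?v $ i * mu ?v i j = 0" for i j
    by (simp add: power2_eq_square power3_eq_cube)
  from \<open>R \<noteq> 0\<close> obtain a where a: "R $ a \<noteq> 0"
    by (auto simp: vec_eq_iff)
  have "\<not> proj_eq (axis a 1) R"
    by (rule off) (auto simp: fermat_points_iff[OF prim])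
  with \<open>R \<noteq> 0\<close> obtain b where "b \<noteq> a" "R $ b \<noteq> 0"
    using ex_nonzero_off_axis by blast
  with mu_all_zero[of ?v a, OF v] a have eq: "R $ j ^ 3 = R $ a ^ 3" for j
    by auto
  with a have 1: "R $ 1 \<noteq> 0"
    by (metis power_eq_0_iff zero_power zero_less_numeral)
  \<comment> \<open>All coordinates have the same nonzero cube, so dividing by the first one gives
    cube roots of unity.\<close>
  define P where "P = (\<chi> j. R $ j / R $ 1)"
  have "R $ i ^ 3 = R $ 1 ^ 3" for i
    using eq[of i] eq[of 1] by simp
  with 1 have "P \<in> fermat_points \<epsilon>"
    unfolding fermat_points_iff[OF prim] by (intro disjI1) (simp add: P_def power_divide)
  moreover have "proj_eq P R"
    unfolding proj_eq_def using 1 by (intro exI[of _ "R $ 1"]) (simp add: P_def vec_eq_iff)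
  ultimately show False using off by blast
qed

text \<open>Multiplicity 3 at the twisted point kills the weighted row \<open>a\<close>. Either
  \<open>R\<close> lies on a coordinate line through \<open>axis a 1\<close>, or its coordinates off
  \<open>a\<close> have equal cubes and become cube roots of unity after scaling.\<close>

lemma mu_quartic_triple_twist_imp_line:
  assumes R: "R \<noteq> 0" and off: "\<And>P. P \<in> fermat_points \<epsilon> \<Longrightarrow> \<not> proj_eq P R"
    and a: "R $ a \<noteq> 0" and triple: "vanishes_to_order 3 (mu_quartic R) (twist a R)"
  obtains P where "P \<in> fermat_points \<epsilon>" "P \<noteq> axis a 1" "on_line_through (axis a 1) P R"
proof -
  let ?v = "\<chi> k. R $ k ^ 3"
  \<comment> \<open>Lying on a line through \<open>axis a 1\<close> only depends on the coordinates
    off \<open>a\<close>, up to a common factor.\<close>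
  have line: "on_line_through (axis a 1) P R" if "\<And>j. j \<noteq> a \<Longrightarrow> R $ j = c * P $ j" for P c
  proof -
    have "R = (R $ a - c * P $ a) *s axis a 1 + c *s P"
      using that by (auto simp: vec_eq_iff axis_def)
    also have "\<dots> \<in> vec.span {axis a 1, P}"
      by (intro vec.span_add vec.span_scale vec.span_base) auto
    finally show ?thesis by (simp add: on_line_through_def)
  qed
  have v: "?v $ j * mu ?v a j = 0" for j
    using mu_quartic_properties(4)[OF triple a, of j] by (auto simp: power3_eq_cube)
  have "\<not> proj_eq (axis a 1) R"
    by (rule off) (auto simp: fermat_points_iff[OF prim])
  with R obtain b where b: "b \<noteq> a" "R $ b \<noteq> 0"
    using ex_nonzero_off_axis by blast
  then consider "\<forall>j. j \<noteq> a \<and> j \<noteq> b \<longrightarrow> R $ j = 0" | "\<forall>j. j \<noteq> a \<longrightarrow> R $ j ^ 3 = R $ b ^ 3"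
    using mu_row_zero[of ?v a b, OF v] by auto
  then show thesis
  proof cases
    case 1
    show thesis
    proof (rule that)
      show "axis b 1 \<in> fermat_points \<epsilon>"
        by (auto simp: fermat_points_iff[OF prim])
      show "axis b 1 \<noteq> (axis a 1 :: complex^4)"
        using b by (simp add: axis_eq_axis)
      show "on_line_through (axis a 1) (axis b 1) R"
        using 1 by (intro line[of "R $ b"]) (auto simp: axis_def)
    qed
  next
    case 2
    \<comment> \<open>The first coordinate of \<open>P\<close> has to be 1. For \<open>a = 1\<close>
      it is the freely chosen entry, and \<open>R $ b\<close> can serve as scale; otherwise the
      scale must be \<open>R $ 1\<close>.\<close>
    define t where "t = (if a = 1 then R $ b else R $ 1)"
    define P where "P = (\<chi> j. if j = a then 1 else R $ j / t)"
    have t3: "t ^ 3 = R $ b ^ 3"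
      using 2 by (auto simp: t_def)
    with b have t: "t \<noteq> 0"
      by auto
    show thesis
    proof (rule that)
      show "P \<in> fermat_points \<epsilon>"
        unfolding fermat_points_iff[OF prim]
      proof (intro disjI1 conjI allI)
        show "P $ 1 = 1"
          using t by (auto simp: P_def t_def split: if_splits)
        show "P $ i ^ 3 = 1" for i
        proof (cases "i = a")
          case False
          with 2 have "R $ i ^ 3 = t ^ 3"
            unfolding t3 by blast
          with False t show ?thesis by (simp add: P_def power_divide)
        qed (simp add: P_def)
      qed
      show "P \<noteq> axis a 1"
        using b t by (auto simp: P_def vec_eq_iff axis_def)
      show "on_line_through (axis a 1) P R"
        using t by (intro line[of t]) (auto simp: P_def)
    qed
  qed
qed

end

section \<open>Upper bound for the space of quartics through the Fermat points\<close>

lemma evalp_scale: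
  assumes "is_form d p"
  shows "evalp p (\<lambda>i. c * v i) = c ^ d * evalp p v"
proof -
  have "(\<Prod>i\<in>UNIV. (c * v i) ^ Poly_Mapping.lookup t i)
      = c ^ d * (\<Prod>i\<in>UNIV. v i ^ Poly_Mapping.lookup t i)" if "t \<in> Poly_Mapping.keys p" for t
  proof -
    have "(\<Prod>i\<in>UNIV. c ^ Poly_Mapping.lookup t i) = c ^ d"
      using assms that by (simp add: is_form_def flip: power_sum)
    then show ?thesis by (simp add: power_mult_distrib prod.distrib)
  qed
  then show ?thesis
    unfolding evalp_def by (simp add: sum_distrib_left mult.left_commute)
qed

text \<open>Orthogonality of characters of the cyclic group of order 3:
  \<open>\<epsilon> ^ n\<close> depends only on \<open>n mod 3\<close>, and
  \<open>1 + \<epsilon> + \<epsilon> ^ 2 = 0\<close>.\<close>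

lemma sum_cube_roots_power:
  assumes "primitive_cube_root \<epsilon>"
  shows "(\<Sum>z | z ^ 3 = 1. z ^ n) = (if 3 dvd n then 3 else 0 :: complex)"
proof -
  note e = cube_roots_of_unity[OF assms]
  have 3: "\<epsilon> ^ 3 = 1" using assms by (simp add: primitive_cube_root_def)
  have "\<epsilon> ^ n = \<epsilon> ^ (3 * (n div 3) + n mod 3)"
    by simp
  also have "\<dots> = \<epsilon> ^ (n mod 3)"
    unfolding power_add power_mult 3 by simp
  finally have mod: "\<epsilon> ^ n = \<epsilon> ^ (n mod 3)" .
  have "(\<Sum>z | z ^ 3 = 1. z ^ n) = 1 + \<epsilon> ^ n + (\<epsilon> ^ 2) ^ n"
    using e(2-4) unfolding e(1) by (simp add: add.assoc)
  also have "(\<epsilon> ^ 2) ^ n = (\<epsilon> ^ n) ^ 2"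
    by (simp add: mult.commute flip: power_mult)
  also note mod
  also have "1 + \<epsilon> ^ (n mod 3) + (\<epsilon> ^ (n mod 3)) ^ 2 = (if 3 dvd n then 3 else 0)"
  proof -
    have "(\<epsilon> ^ 2) ^ 2 = \<epsilon>"
      using 3 by (simp add: eval_nat_numeral)
    moreover have "n mod 3 = 0 \<or> n mod 3 = 1 \<or> n mod 3 = 2" by linarith
    ultimately show ?thesis
      using e(5) by (auto simp: dvd_eq_mod_eq_0 algebra_simps)
  qed
  finally show ?thesis .
qed

text \<open>
  Fourier inversion on the group of vectors of cube roots of unity: vanishing there means that the
  coefficients sum to zero over each class of exponent vectors modulo 3.
\<close>

lemma sum_coeffs_mod_3_class:
  fixes p :: "'n::finite cpoly"
  assumes "primitive_cube_root \<epsilon>" "\<And>v. (\<And>i. v i ^ 3 = 1) \<Longrightarrow> evalp p v = 0"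
  shows "(\<Sum>t\<in>Poly_Mapping.keys p. if \<forall>i. 3 dvd Poly_Mapping.lookup t i + s i
            then Poly_Mapping.lookup p t else 0) = 0"
proof -
  let ?U = "{z::complex. z ^ 3 = 1}" and ?V = "PiE (UNIV :: 'n set) (\<lambda>_. {z::complex. z ^ 3 = 1})"
  have fin: "finite ?U"
    unfolding cube_roots_of_unity(1)[OF assms(1)] by simp
  have char: "(\<Sum>v\<in>?V. \<Prod>i\<in>UNIV. v i ^ (Poly_Mapping.lookup t i + s i)) =
      (if \<forall>i. 3 dvd Poly_Mapping.lookup t i + s i then 3 ^ CARD('n) else 0)" for t
  proof -
    have "(\<Sum>v\<in>?V. \<Prod>i\<in>UNIV. v i ^ (Poly_Mapping.lookup t i + s i)) =
        (\<Prod>i\<in>UNIV. \<Sum>z\<in>?U. z ^ (Poly_Mapping.lookup t i + s i))"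
      by (rule prod_sum_PiE[symmetric]) (use fin in auto)
    also have "\<dots> = (\<Prod>i\<in>UNIV. if 3 dvd Poly_Mapping.lookup t i + s i then 3 else 0)"
      unfolding sum_cube_roots_power[OF assms(1)] ..
    also have "\<dots> = (if \<forall>i. 3 dvd Poly_Mapping.lookup t i + s i then 3 ^ CARD('n) else 0)"
      by auto
    finally show ?thesis .
  qed
  \<comment> \<open>Weighting the values with the monomial of exponent \<open>s\<close> picks out
    the exponents congruent to \<open>-s\<close> modulo 3.\<close>
  have "0 = (\<Sum>v\<in>?V. evalp p v * (\<Prod>i\<in>UNIV. v i ^ s i))"
    using assms(2) by (intro sum.neutral[symmetric]) (auto simp: PiE_iff)
  also have "\<dots> = (\<Sum>v\<in>?V. \<Sum>t\<in>Poly_Mapping.keys p. Poly_Mapping.lookup p t *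
      (\<Prod>i\<in>UNIV. v i ^ (Poly_Mapping.lookup t i + s i)))"
    by (simp add: evalp_def sum_distrib_right power_add prod.distrib mult.assoc)
  also have "\<dots> = (\<Sum>t\<in>Poly_Mapping.keys p. Poly_Mapping.lookup p t *
      (\<Sum>v\<in>?V. \<Prod>i\<in>UNIV. v i ^ (Poly_Mapping.lookup t i + s i)))"
    by (subst sum.swap) (simp add: sum_distrib_left)
  also have "\<dots> = 3 ^ CARD('n) * (\<Sum>t\<in>Poly_Mapping.keys p.
      if \<forall>i. 3 dvd Poly_Mapping.lookup t i + s i then Poly_Mapping.lookup p t else 0)"
    unfolding char sum_distrib_left by (rule sum.cong) auto
  finally show ?thesis by simp
qed

text \<open>If all entries of \<open>t\<close> are at most 2, every exponent vector congruent to
  \<open>t\<close> modulo 3 dominates \<open>t\<close>. So \<open>t\<close> is alone in its class in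
  degree \<open>d\<close>, and its coefficient is the class sum, which is zero.\<close>

lemma large_exponent_if_vanishes_on_roots_of_unity:
  fixes p :: "'n::finite cpoly"
  assumes prim: "primitive_cube_root \<epsilon>" and form: "is_form d p"
    and van: "\<And>v. (\<And>i. v i ^ 3 = 1) \<Longrightarrow> evalp p v = 0"
    and t: "t \<in> Poly_Mapping.keys p"
  shows "\<exists>j. Poly_Mapping.lookup t j \<ge> 3"
proof (rule ccontr)
  assume "\<not> ?thesis"
  then have small: "Poly_Mapping.lookup t i \<le> 2" for i
    by (metis Suc_leI eval_nat_numeral(3) leI numeral_2_eq_2)
  \<comment> \<open>Adding \<open>2 * t\<close> tests congruence to \<open>t\<close>, since 2 is -1
    modulo 3.\<close>
  have same_class: "(\<forall>i. 3 dvd Poly_Mapping.lookup u i + 2 * Poly_Mapping.lookup t i) \<longleftrightarrow> u = t"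
    if u: "u \<in> Poly_Mapping.keys p" for u
  proof
    assume dvd: "\<forall>i. 3 dvd Poly_Mapping.lookup u i + 2 * Poly_Mapping.lookup t i"
    have "b \<le> a" if "3 dvd a + 2 * b" "b \<le> 2" for a b :: nat
      using that by presburger
    then have le: "Poly_Mapping.lookup t i \<le> Poly_Mapping.lookup u i" for i
      using dvd small by blast
    have "(\<Sum>i\<in>UNIV. Poly_Mapping.lookup t i) = (\<Sum>i\<in>UNIV. Poly_Mapping.lookup u i)"
      using form t u by (simp add: is_form_def)
    then have "Poly_Mapping.lookup t i = Poly_Mapping.lookup u i" for i
      using sum_mono_inv[of "Poly_Mapping.lookup t" UNIV "Poly_Mapping.lookup u" i] le by simp
    then show "u = t" by (simp add: poly_mapping_eqI)
  qed simp
  have "(\<Sum>u\<in>Poly_Mapping.keys p. if u = t then Poly_Mapping.lookup p u else 0) = 0"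
    using sum_coeffs_mod_3_class[OF prim van, of "\<lambda>i. 2 * Poly_Mapping.lookup t i"]
    by (simp add: same_class cong: sum.cong)
  with t show False by (simp add: in_keys_iff)
qed

lemma quartic_exponent_eq_mon:
  fixes t :: "'n::finite \<Rightarrow>\<^sub>0 nat"
  assumes "(\<Sum>i\<in>UNIV. Poly_Mapping.lookup t i) = 4" "Poly_Mapping.lookup t j \<ge> 3"
  obtains i where "t = mon i j 3"
proof -
  define f where "f k = Poly_Mapping.lookup t k - (if k = j then 3 else 0)" for k
  have f: "Poly_Mapping.lookup t k = f k + (if k = j then 3 else 0)" for k
    using assms(2) by (auto simp: f_def)
  have "(\<Sum>k\<in>UNIV. f k) = 1"
    using assms(1) unfolding f sum.distrib by simp
  then obtain i where i: "f i = 1" "\<And>k. k \<noteq> i \<Longrightarrow> f k = 0"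
    using sum_eq_1_iff[of UNIV f] by auto
  have "t = mon i j 3"
    by (rule poly_mapping_eqI) (use i in \<open>auto simp: f lookup_mon\<close>)
  then show thesis by (rule that)
qed

text \<open>The 27 points force an exponent of at least 3, which in degree 4 leaves only the
  monomials \<open>x_i x_j^3\<close>; the coordinate points clear the diagonal.\<close>

lemma forms_through_fermat_eq_quartic13:
  fixes p :: "4 cpoly"
  assumes prim: "primitive_cube_root \<epsilon>" and p: "p \<in> forms_through 4 (fermat_points \<epsilon>)"
  defines "l \<equiv> \<lambda>i j. Poly_Mapping.lookup p (mon i j 3)"
  shows "p = quartic13 l" and "l i i = 0" and "(\<Sum>j\<in>UNIV. l i j) = 0"
proof -
  from p have form: "is_form 4 p" and van: "\<And>P. P \<in> fermat_points \<epsilon> \<Longrightarrow> evalp p (($) P) = 0"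
    by (auto simp: forms_through_def vanishes_at_def)
  have torus: "evalp p v = 0" if v: "\<And>i. v i ^ 3 = 1" for v
  proof -
    have v1: "v 1 \<noteq> 0"
      using v[of 1] by auto
    define P where "P = (\<chi> i. v i / v 1)"
    have "P \<in> fermat_points \<epsilon>"
      unfolding fermat_points_iff[OF prim] using v1 v by (simp add: P_def power_divide)
    moreover have "evalp p v = v 1 ^ 4 * evalp p (($) P)"
      using v1 by (simp add: P_def flip: evalp_scale[OF form])
    ultimately show ?thesis using van by simp
  qed
  show eq: "p = quartic13 l"
  proof (rule poly_mapping_eqI)
    fix t
    show "Poly_Mapping.lookup p t = Poly_Mapping.lookup (quartic13 l) t"
    proof (cases "\<exists>i j. t = mon i j 3")
      case True
      then show ?thesis by (auto simp: lookup_quartic13_mon l_def)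
    next
      case False
      have "t \<notin> Poly_Mapping.keys p"
      proof
        assume t: "t \<in> Poly_Mapping.keys p"
        obtain j where "Poly_Mapping.lookup t j \<ge> 3"
          using large_exponent_if_vanishes_on_roots_of_unity[OF prim form torus t] by blast
        moreover have "(\<Sum>i\<in>UNIV. Poly_Mapping.lookup t i) = 4"
          using form t by (simp add: is_form_def)
        ultimately show False
          using False quartic_exponent_eq_mon by blast
      qed
      moreover have "Poly_Mapping.lookup (quartic13 l) t = 0"
        unfolding lookup_quartic13 using False by (intro sum.neutral ballI) auto
      ultimately show ?thesis by (simp add: in_keys_iff)
    qed
  qed
  have "axis i 1 \<in> fermat_points \<epsilon>"
    by (auto simp: fermat_points_iff[OF prim])
  then have "vanishes_at (quartic13 l) (axis i 1)"
    using van by (simp add: vanishes_at_def flip: eq)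
  then show "l i i = 0"
    by (simp add: vanishes_at_quartic13_axis)
  have e: "\<epsilon> ^ 3 = 1" "\<epsilon> \<noteq> 1"
    using cube_roots_of_unity[OF prim] prim by (auto simp: primitive_cube_root_def)
  let ?L = "\<lambda>i. \<Sum>j\<in>UNIV. l i j"
  have L: "(\<Sum>k\<in>UNIV. v k * ?L k) = 0" if "\<And>k. v k ^ 3 = 1" for v
    using torus[OF that] that by (simp add: eq evalp_quartic13)
  \<comment> \<open>Switching coordinate \<open>i\<close> from 1 to \<epsilon> changes the sum in
    \<open>L\<close> by \<open>(\<epsilon> - 1) * ?L i\<close>, and it vanishes both before and
    after.\<close>
  have "(\<Sum>k\<in>UNIV. (if k = i then \<epsilon> else 1) * ?L k) =
      (\<Sum>k\<in>UNIV. 1 * ?L k + (if k = i then (\<epsilon> - 1) * ?L k else 0))"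
    by (rule sum.cong) (auto simp: algebra_simps)
  also have "\<dots> = (\<Sum>k\<in>UNIV. 1 * ?L k) + (\<epsilon> - 1) * ?L i"
    unfolding sum.distrib by simp
  finally have "(\<epsilon> - 1) * ?L i = 0"
    using L[of "\<lambda>k. if k = i then \<epsilon> else 1"] L[of "\<lambda>k. 1"] e(1) by simp
  with e(2) show "?L i = 0" by simp
qed

text \<open>A row with zero diagonal and zero sum has two free entries once the entry at
  \<open>i + 1\<close> is eliminated, which gives 4 * 2 = 8 differences of monomials. Addition in
  type \<open>4\<close> is cyclic, so \<open>i + 1\<close> always differs from
  \<open>i\<close>.\<close>

lemma forms_through_fermat_span:
  assumes prim: "primitive_cube_root \<epsilon>"
  obtains B where "finite B" "card B \<le> 8" "forms_through 4 (fermat_points \<epsilon>) \<subseteq> cpoly.span B"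
proof
  let ?S = "SIGMA i:(UNIV :: 4 set). UNIV - {i, i + 1}"
  let ?m = "\<lambda>i j. Poly_Mapping.single (mon i j 3) (1 :: complex)"
  let ?B = "(\<lambda>(i, j). ?m i j - ?m i (i + 1)) ` ?S"
  have card: "card (UNIV - {i, i + 1}) = 2" for i :: 4
    by (simp add: card_Diff_subset)
  show "finite ?B" by simp
  have "card ?B \<le> card ?S"
    by (intro card_image_le) simp
  also have "\<dots> = 8"
    by (simp add: card)
  finally show "card ?B \<le> 8" .
  show "forms_through 4 (fermat_points \<epsilon>) \<subseteq> cpoly.span ?B"
  proof
    fix p :: "4 cpoly"
    assume p: "p \<in> forms_through 4 (fermat_points \<epsilon>)"
    define l where "l = (\<lambda>i j. Poly_Mapping.lookup p (mon i j 3))"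
    have l: "p = quartic13 l" "l i i = 0" "(\<Sum>j\<in>UNIV. l i j) = 0" for i
      unfolding l_def by (rule forms_through_fermat_eq_quartic13[OF prim p])+
    have single: "Poly_Mapping.single t c = cscale c (Poly_Mapping.single t 1)" for t :: "4 \<Rightarrow>\<^sub>0 nat" and c
      by (simp add: cscale_def)
    have split: "(\<Sum>j\<in>UNIV. f j) = f i + f (i + 1) + (\<Sum>j\<in>UNIV - {i, i + 1}. f j)"
      for i :: 4 and f :: "4 \<Rightarrow> 'a::comm_monoid_add"
      by (subst sum.subset_diff[of "{i, i + 1}"]) (simp_all add: add.commute)
    have row: "(\<Sum>j\<in>UNIV. Poly_Mapping.single (mon i j 3) (l i j)) =
        (\<Sum>j\<in>UNIV - {i, i + 1}. cscale (l i j) (?m i j - ?m i (i + 1)))" for i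
    proof -
      have "l i (i + 1) = - (\<Sum>j\<in>UNIV - {i, i + 1}. l i j)"
        using l(3)[of i] l(2)[of i] unfolding split[of _ i] by (simp add: add_eq_0_iff)
      then show ?thesis
        unfolding split[of _ i] single[of _ "l _ _"]
        by (simp add: l(2) cpoly.scale_right_diff_distrib sum_subtractf cpoly.scale_minus_left
            cpoly.scale_sum_left)
    qed
    have "p = (\<Sum>i\<in>UNIV. \<Sum>j\<in>UNIV - {i, i + 1}. cscale (l i j) (?m i j - ?m i (i + 1)))"
      by (subst l(1)) (simp add: quartic13_def row)
    also have "\<dots> \<in> cpoly.span ?B"
      by (intro cpoly.span_sum cpoly.span_scale cpoly.span_base) force
    finally show "p \<in> cpoly.span ?B" .
  qed
qed

section \<open>Speciality of the linear system\<close>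

lemma cpoly_dim_pos:
  assumes "finite B" "V \<subseteq> cpoly.span B" "q \<in> V" "q \<noteq> 0"
  shows "cpoly.dim V > 0"
proof -
  obtain C where C: "C \<subseteq> V" "cpoly.independent C" "V \<subseteq> cpoly.span C" "card C = cpoly.dim V"
    using cpoly.basis_exists by blast
  \<comment> \<open>Infinite sets have cardinality 0, so a positive dimension requires a finite
    basis; the finite spanning set \<open>B\<close> provides it.\<close>
  have "finite C"
    using cpoly.independent_span_bound[OF assms(1) C(2)] C(1) assms(2) by blast
  moreover have "C \<noteq> {}"
    using C(3) assms(3,4) by auto
  ultimately show ?thesis
    using C(4) by (metis card_gt_0_iff)
qed

lemma special_system_fermat:
  assumes prim: "primitive_cube_root \<epsilon>"
  shows "special_system 4 (fermat_points \<epsilon>) (\<lambda>_ :: unit. 3)"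
proof -
  obtain B where B: "finite B" "card B \<le> 8" "forms_through 4 (fermat_points \<epsilon>) \<subseteq> cpoly.span B"
    using forms_through_fermat_span[OF prim] .
  have "cpoly.dim (forms_through 4 (fermat_points \<epsilon>)) \<le> 8"
    using cpoly.dim_le_card[OF B(3,1)] B(2) by linarith
  \<comment> \<open>The number of conditions of a triple point in 3-space; it exceeds the bound 8,
    so the maximum in \<open>expected_dim\<close> is -1.\<close>
  moreover have "(5::nat) choose 3 = 10"
    by (simp add: eval_nat_numeral)
  ultimately have expected: "expected_dim 4 (fermat_points \<epsilon>) (\<lambda>_ :: unit. 3) = - 1"
    by (simp add: expected_dim_def)
  \<comment> \<open>The quartic \<open>x\<^sub>3 (x\<^sub>1\<^sup>3 - x\<^sub>2\<^sup>3)\<close> passes through all Fermat points.\<close>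
  define F :: "(unit \<times> 4) cpoly" where
    "F = Poly_Mapping.single (mon ((), 3) ((), 1) 3) 1 + Poly_Mapping.single (mon ((), 3) ((), 2) 3) (- 1)"
  have F: "evalp F v = v ((), 3) * (v ((), 1) ^ 3 - v ((), 2) ^ 3)" for v
    by (simp add: F_def evalp_add evalp_mon algebra_simps)
  have "evalp F (\<lambda>(_, j). if j = 2 then 0 else 1) \<noteq> 0"
    by (simp add: F)
  then have "F \<noteq> 0" by auto
  moreover have "- 1 < proj_dim (linear_system 4 (fermat_points \<epsilon>) (\<lambda>_. 3) P)"
    if P: "P () \<noteq> 0" "evalp F (\<lambda>(i, j). P i $ j) \<noteq> 0" for P :: "unit \<Rightarrow> complex^4"
  proof -
    have "\<not> proj_eq W (P ())" if W: "W \<in> fermat_points \<epsilon>" for W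
    proof
      assume "proj_eq W (P ())"
      then obtain c where "P () = c *s W"
        by (auto simp: proj_eq_def)
      then have "evalp F (\<lambda>(i, j). P i $ j) = c ^ 4 * (W $ 3 * (W $ 1 ^ 3 - W $ 2 ^ 3))"
        by (simp add: F algebra_simps power_mult_distrib eval_nat_numeral)
      moreover have "W $ 3 * (W $ 1 ^ 3 - W $ 2 ^ 3) = 0"
        using W exhaust_4 by (auto simp: fermat_points_iff[OF prim] axis_def)
      ultimately show False using P(2) by simp
    qed
    then have "mu_quartic (P ()) \<noteq> 0"
      by (rule mu_quartic_nonzero[OF prim P(1)])
    moreover have "mu_quartic (P ()) \<in> linear_system 4 (fermat_points \<epsilon>) (\<lambda>_. 3) P"
      by (simp add: linear_system_def forms_through_def mu_quartic_properties(1,2)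
          mu_quartic_vanishes_at_fermat[OF prim])
    moreover have "linear_system 4 (fermat_points \<epsilon>) (\<lambda>_. 3) P \<subseteq> cpoly.span B"
      using B(3) by (auto simp: linear_system_def)
    ultimately show ?thesis
      using cpoly_dim_pos[OF B(1)] by (fastforce simp: proj_dim_def)
  qed
  ultimately show ?thesis
    unfolding special_system_def for_generic_points_def expected by blast
qed

text \<open>The provisos reflect degenerate positions. For \<open>R $ i = 0\<close> the twisted
  point is \<open>R\<close> itself; for \<open>R\<close> on a line joining \<open>axis i 1\<close>
  to another point of \<open>W\<close>, the weighted row \<open>i\<close> of \<open>mu\<close>
  vanishes and the constructed quartic has multiplicity at least 3 at the twisted point.\<close>

theorem theorem6:
  fixes \<epsilon> :: complex and W :: "(complex^4) set"
  assumes "primitive_cube_root \<epsilon>"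
    and "W = fermat_points \<epsilon>"
  shows "special_system 4 W (\<lambda>_ :: unit. 3) \<and>
    (\<forall>R :: complex^4. R \<noteq> 0 \<and> (\<forall>P\<in>W. \<not> proj_eq P R) \<longrightarrow>
      (\<exists>Q :: 4 cpoly.
        Q \<noteq> 0 \<and> is_form 4 Q \<and> vanishes_to_order 3 Q R \<and> (\<forall>P\<in>W. vanishes_at Q P) \<and>
        (\<forall>i. singular_at Q (twist i R)) \<and>
        (\<forall>i. R $ i \<noteq> 0 \<longrightarrow>
           \<not> proj_eq R (twist i R) \<and>
           (\<forall>j. j \<noteq> i \<longrightarrow> \<not> proj_eq (twist i R) (twist j R))) \<and>
        (\<forall>i. R $ i \<noteq> 0 \<and> (\<forall>P\<in>W. P \<noteq> axis i 1 \<longrightarrow> \<not> on_line_through (axis i 1) P R) \<longrightarrow>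
           double_point Q (twist i R))))"
proof (intro conjI allI impI, goal_cases)
  case 1
  show ?case
    using special_system_fermat assms by simp
next
  case (2 R)
  then have R: "R \<noteq> 0" and off: "\<And>P. P \<in> fermat_points \<epsilon> \<Longrightarrow> \<not> proj_eq P R"
    using assms(2) by auto
  note prim = assms(1)
  have not_proj: "\<not> proj_eq R (twist i R) \<and> (\<forall>j. j \<noteq> i \<longrightarrow> \<not> proj_eq (twist i R) (twist j R))"
    if "R $ i \<noteq> 0" for i
  proof -
    have "\<not> proj_eq (axis i 1) R"
      by (rule off) (auto simp: fermat_points_iff[OF prim])
    then obtain b where "b \<noteq> i" "R $ b \<noteq> 0"
      using ex_nonzero_off_axis R by blast
    with that show ?thesis using not_proj_eq_twist by blast
  qed
  have double: "double_point (mu_quartic R) (twist i R)"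
    if "R $ i \<noteq> 0" "\<forall>P\<in>fermat_points \<epsilon>. P \<noteq> axis i 1 \<longrightarrow> \<not> on_line_through (axis i 1) P R" for i
    unfolding double_point_def
  proof
    show "vanishes_to_order 2 (mu_quartic R) (twist i R)"
      using mu_quartic_properties(3)[of R i] by (simp add: singular_at_def)
    show "\<not> vanishes_to_order 3 (mu_quartic R) (twist i R)"
      using mu_quartic_triple_twist_imp_line[OF prim R off that(1)] that(2) by blast
  qed
  show ?case
    unfolding assms(2)
    by (intro exI[of _ "mu_quartic R"] conjI)
      (use mu_quartic_nonzero[OF prim R off] mu_quartic_properties[of R]
        mu_quartic_vanishes_at_fermat[OF prim] not_proj double in blast)+
qed

end
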